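(* Let $G$ be a finite simple graph such that $I(G)^s$ has linear quotients for some integer $s\ge 1$, and fix a vertex $x$ of $G$. Then $I(G^{[x]})^s$ has linear quotients if and only if $G^{[x]}$ is gapfree.
   Context: For a finite simple graph $G$ on vertices $1,\ldots,n$, its edge ideal $I(G)\subseteq K[x_1,\ldots,x_n]$ ($K$ a field) is generated by the monomials $x_ix_j$ for the edges $\{i,j\}$ of $G$. A monomial ideal generated in a single degree has linear quotients if its minimal monomial generators can be ordered $u_1>\cdots>u_r$ so that each colon ideal $(u_1,\ldots,u_i):u_{i+1}$, $1\le i<r$, is generated by a subset of the variables. A graph is gapfree if for any two edges $e,e'$ with $e\cap e'=\emptyset$ there is an edge $f$ with $e\cap f\neq\emptyset$ and $e'\cap f\neq\emptyset$. The expansion $G^{[x]}$ of $G$ at $x$ is obtained by adding a new vertex $y$ with edge set $E(G)\cup\{yb : xb\in E(G)\}\cup\{xy\}$ (with a new variable for $y$). *)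

theory Defs
  imports Main "HOL-Library.Multiset"
begin

text \<open>Monomials in variables of type 'v are represented by their exponent
vectors, i.e. finite multisets of variables; multiplication is (+) and
divisibility is the sub-multiset relation.  A monomial ideal of
K[x_v] is determined by (and identified with) the set of monomials it contains.\<close>

type_synonym 'v monomial = "'v multiset"

definition ideal_gen :: "'v monomial set \<Rightarrow> 'v monomial set" where
  "ideal_gen U = {m. \<exists>u\<in>U. u \<subseteq># m}"

definition colon :: "'v monomial set \<Rightarrow> 'v monomial \<Rightarrow> 'v monomial set" where
  "colon I u = {m. m + u \<in> I}"

definition min_gens :: "'v monomial set \<Rightarrow> 'v monomial set" where
  "min_gens I = {u \<in> I. \<forall>v\<in>I. v \<subseteq># u \<longrightarrow> v = u}"

definition linear_quotients :: "'v monomial set \<Rightarrow> bool" where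
  "linear_quotients I \<longleftrightarrow>
     (\<exists>us. distinct us \<and> set us = min_gens I \<and>
        (\<forall>i. 1 \<le> i \<and> i < length us \<longrightarrow>
           (\<exists>S. colon (ideal_gen (set (take i us))) (us ! i)
                 = ideal_gen ((\<lambda>v. {#v#}) ` S))))"

definition simple_graph :: "'a set \<Rightarrow> 'a set set \<Rightarrow> bool" where
  "simple_graph V E \<longleftrightarrow> finite V \<and> (\<forall>e\<in>E. e \<subseteq> V \<and> card e = 2)"

definition edge_ideal :: "'a set set \<Rightarrow> 'a monomial set" where
  "edge_ideal E = ideal_gen (mset_set ` E)"

definition edge_ideal_pow :: "'a set set \<Rightarrow> nat \<Rightarrow> 'a monomial set" where
  "edge_ideal_pow E s =
     ideal_gen {sum_list (map mset_set es) | es. length es = s \<and> set es \<subseteq> E}"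

definition gapfree :: "'a set set \<Rightarrow> bool" where
  "gapfree E \<longleftrightarrow> (\<forall>e\<in>E. \<forall>e'\<in>E. e \<inter> e' = {} \<longrightarrow>
                      (\<exists>f\<in>E. e \<inter> f \<noteq> {} \<and> e' \<inter> f \<noteq> {}))"

text \<open>Expansion at x: old vertices v become Some v, the new vertex y is None.\<close>
definition expansion_vertices :: "'a set \<Rightarrow> 'a option set" where
  "expansion_vertices V = Some ` V \<union> {None}"

definition expansion_edges :: "'a set set \<Rightarrow> 'a \<Rightarrow> 'a option set set" where
  "expansion_edges E x =
     (\<lambda>e. Some ` e) ` E \<union> {{None, Some b} | b. {x, b} \<in> E} \<union> {{Some x, None}}"

end

theory Submission
  imports Defs "HOL-Library.List_Lexorder"
begin

text \<open>
  If \<open>e, e'\<close> form a gap, then the powers \<open>e\<^sup>s\<close> and \<open>e'\<^sup>s\<close> already violate linear quotients: no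
  product of edges differs from \<open>e\<^sup>s\<close> by trading one variable for a variable of \<open>e'\<close>.

  Conversely, if the expansion is gapfree, the edge \<open>xy\<close> forces the neighbourhood \<open>N\<close> of \<open>x\<close> to be a
  vertex cover of \<open>G\<close>.  The products of \<open>s\<close> edges with \<open>N\<close>-degree at least \<open>s\<close> are exactly those that
  can be written without the edge \<open>xy\<close>, i.e. the preimages of the generators of \<open>I(G)\<^sup>s\<close> under
  \<open>y \<mapsto> x\<close>; they come first, in the given order of \<open>I(G)\<^sup>s\<close>.  Every other generator \<open>M\<close> is divisible by
  \<open>xy\<close>, so that \<open>x\<close> can be traded for any \<open>p \<in> N\<close>; hence larger \<open>N\<close>-degree is placed first.  Among
  equal \<open>N\<close>-degrees one trades vertices outside \<open>N \<union> {x, y}\<close> for \<open>x\<close> or \<open>y\<close>, then \<open>y\<close> for \<open>x\<close>.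
  Generators that agree on \<open>N \<union> {x, y}\<close> satisfy a matroid-type exchange property, so a lexicographic
  order works for them.
\<close>

section \<open>Linear quotients of equigenerated ideals\<close>

text \<open>For generators of one degree, the colon ideal at \<open>u\<close> is generated by
  variables iff for each earlier \<open>u'\<close> some variable \<open>v\<close> dividing
  \<open>u' / gcd(u, u')\<close> makes \<open>v * u\<close> a multiple of an earlier
  \<open>m\<close>. Equal degrees make the cofactor a single variable \<open>w\<close>.\<close>

definition linear_step :: "'v multiset set \<Rightarrow> ('v multiset \<Rightarrow> 'k::linorder) \<Rightarrow> 'v multiset \<Rightarrow> 'v multiset \<Rightarrow> bool" where
  "linear_step P key u u' \<longleftrightarrow>
     (\<exists>m v w. m \<in> P \<and> key m < key u \<and> add_mset v u = add_mset w m \<and> count u v < count u' v)"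

lemma linear_stepI:
  assumes "u = add_mset w R" "add_mset v R \<in> P" "key (add_mset v R) < key u" "count u v < count u' v"
  shows "linear_step P key u u'"
  unfolding linear_step_def using assms by (metis add_mset_commute)

text \<open>Between monomials of equal degree, divisibility is equality.\<close>

lemma min_gens_ideal_gen:
  assumes "\<And>u. u \<in> P \<Longrightarrow> size u = d"
  shows "min_gens (ideal_gen P) = P"
proof -
  have *: "u = v" if "u \<in> P" "v \<in> P" "u \<subseteq># v" for u v
    using that assms by (metis mset_subset_size order_less_irrefl subset_mset.le_imp_less_or_eq)
  show ?thesis
    unfolding min_gens_def ideal_gen_def
    by (auto; metis * subset_mset.order_trans subset_mset.order_refl subset_mset.antisym)
qed

lemma linear_quotientsI:
  fixes P :: "'v multiset set" and key :: "'v multiset \<Rightarrow> 'k::linorder"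
  assumes fin: "finite P" and sz: "\<And>u. u \<in> P \<Longrightarrow> size u = d"
    and inj: "inj_on key P"
    and step: "\<And>u u'. u \<in> P \<Longrightarrow> u' \<in> P \<Longrightarrow> key u' < key u \<Longrightarrow> linear_step P key u u'"
  shows "linear_quotients (ideal_gen P)"
proof -
  define ks where "ks = sorted_list_of_set (key ` P)"
  define us where "us = map (inv_into P key) ks"
  have ks: "set ks = key ` P" "distinct ks" "sorted_wrt (<) ks"
    using fin by (auto simp: ks_def)
  have setus: "set us = P"
    using inj ks(1) by (auto simp: us_def image_image)
  have dist: "distinct us"
    unfolding us_def distinct_map using ks by (auto simp: inj_on_inv_into)
  have keyus: "key (us ! i) = ks ! i" if "i < length us" for i
    using that ks(1) by (auto simp: us_def intro!: f_inv_into_f) (metis nth_mem ks(1))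
  have less: "key (us ! i) < key (us ! j) \<longleftrightarrow> i < j" if "i < length us" "j < length us" for i j
    using that ks(3) keyus us_def
    by (metis length_map linorder_neqE_nat order_less_asym order_less_irrefl sorted_wrt_nth_less)
  have "\<exists>S. colon (ideal_gen (set (take i us))) (us ! i) = ideal_gen ((\<lambda>v. {#v#}) ` S)"
    if i: "i < length us" for i
  proof
    let ?C = "colon (ideal_gen (set (take i us))) (us ! i)"
    \<comment> \<open>\<open>S\<close> consists of all variables in the colon ideal. The main
      inclusion is that one of them divides each monomial of the colon.\<close>
    have "m \<in> ideal_gen ((\<lambda>v. {#v#}) ` {v. {#v#} \<in> ?C})" if "m \<in> ?C" for m
    proof -
      from that obtain j where j: "j < i" "us ! j \<subseteq># m + us ! i"
        using i by (auto simp: colon_def ideal_gen_def in_set_conv_nth)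
      have "linear_step P key (us ! i) (us ! j)"
        using i j less setus by (intro step) auto
      then obtain n v w where n: "n \<in> P" "key n < key (us ! i)"
        "add_mset v (us ! i) = add_mset w n" "count (us ! i) v < count (us ! j) v"
        unfolding linear_step_def by blast
      obtain k where k: "k < length us" "n = us ! k"
        using n(1) setus by (metis in_set_conv_nth)
      then have "k < i" using less i n(2) by blast
      then have "n \<in> set (take i us)" using k i by (auto simp: in_set_conv_nth)
      moreover have "n \<subseteq># {#v#} + us ! i" using n(3) by simp
      ultimately have "{#v#} \<in> ?C" by (auto simp: colon_def ideal_gen_def)
      \<comment> \<open>\<open>us ! j\<close> divides \<open>m + us ! i\<close> but contains
        \<open>v\<close> more often than \<open>us ! i\<close> does.\<close>
      moreover have "v \<in># m"
        using n(4) mset_subset_eq_count[OF j(2), of v] by (auto simp flip: count_greater_zero_iff)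
      ultimately show ?thesis by (auto simp: ideal_gen_def)
    qed
    moreover have "m \<in> ?C" if mC: "m \<in> ideal_gen ((\<lambda>v. {#v#}) ` {v. {#v#} \<in> ?C})" for m
    proof -
      from mC obtain v where "{#v#} \<in> ?C" "{#v#} \<subseteq># m" unfolding ideal_gen_def by auto
      then obtain u where "u \<in> set (take i us)" "u \<subseteq># {#v#} + us ! i" "{#v#} \<subseteq># m"
        by (auto simp: colon_def ideal_gen_def)
      then have "u \<subseteq># m + us ! i"
        by (meson subset_mset.add_right_mono subset_mset.order_trans)
      then show ?thesis using \<open>u \<in> _\<close> by (auto simp: colon_def ideal_gen_def)
    qed
    ultimately show "?C = ideal_gen ((\<lambda>v. {#v#}) ` {v. {#v#} \<in> ?C})" by blast
  qed
  moreover have "min_gens (ideal_gen P) = P" by (rule min_gens_ideal_gen[OF sz])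
  ultimately show ?thesis
    unfolding linear_quotients_def using dist setus by auto
qed

lemma linear_quotientsE:
  fixes P :: "'v multiset set"
  assumes lq: "linear_quotients (ideal_gen P)" and sz: "\<And>u. u \<in> P \<Longrightarrow> size u = d"
  obtains key :: "'v multiset \<Rightarrow> nat" where "inj_on key P"
    "\<And>u u'. u \<in> P \<Longrightarrow> u' \<in> P \<Longrightarrow> key u' < key u \<Longrightarrow> linear_step P key u u'"
proof -
  have "min_gens (ideal_gen P) = P" by (rule min_gens_ideal_gen[OF sz])
  then obtain us where us: "distinct us" "set us = P"
    "\<And>i. 1 \<le> i \<Longrightarrow> i < length us \<Longrightarrow>
      \<exists>S. colon (ideal_gen (set (take i us))) (us ! i) = ideal_gen ((\<lambda>v. {#v#}) ` S)"
    using lq unfolding linear_quotients_def by auto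
  define key where "key u = (LEAST i. us ! i = u)" for u
  have key: "us ! key u = u \<and> key u < length us" if uP: "u \<in> P" for u
  proof -
    obtain i where i: "i < length us" "us ! i = u" using uP us(2) by (metis in_set_conv_nth)
    have "us ! key u = u" unfolding key_def using LeastI[of "\<lambda>i. us ! i = u" i] i(2) by simp
    moreover have "key u \<le> i" unfolding key_def using Least_le[of "\<lambda>i. us ! i = u" i] i(2) by simp
    ultimately show ?thesis using i(1) by simp
  qed
  have "inj_on key P" using key by (metis inj_onI)
  moreover have "linear_step P key u u'" if uu: "u \<in> P" "u' \<in> P" "key u' < key u" for u u'
  proof -
    let ?T = "set (take (key u) us)"
    obtain S where S: "colon (ideal_gen ?T) u = ideal_gen ((\<lambda>v. {#v#}) ` S)"
      using us(3)[of "key u"] key[OF uu(1)] uu(3) by auto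
    have "u' \<in> ?T" using key[OF uu(1)] key[OF uu(2)] uu(3)
      by (auto simp: in_set_conv_nth)
    \<comment> \<open>The truncated difference \<open>u' - u\<close> is the monomial
      \<open>u' / gcd(u, u')\<close>. It lies in the colon ideal, so a variable of \<open>S\<close>
      divides it.\<close>
    moreover have "u' \<subseteq># (u' - u) + u" by (auto simp: subseteq_mset_def)
    ultimately have "u' - u \<in> colon (ideal_gen ?T) u" by (auto simp: colon_def ideal_gen_def)
    then obtain v where v: "v \<in> S" "v \<in># u' - u"
      unfolding S by (auto simp: ideal_gen_def)
    then have "{#v#} \<in> colon (ideal_gen ?T) u" unfolding S by (auto simp: ideal_gen_def)
    then obtain m where m: "m \<in> ?T" "m \<subseteq># add_mset v u" by (auto simp: colon_def ideal_gen_def)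
    then obtain j where j: "j < key u" "m = us ! j" "j < length us"
      using key[OF uu(1)] by (auto simp: in_set_conv_nth)
    have mP: "m \<in> P" using us(2) j by auto
    have "key m \<le> j" unfolding key_def using Least_le[of "\<lambda>i. us ! i = m" j] j by simp
    obtain R where R: "add_mset v u = m + R" using m(2) by (metis subset_mset.le_iff_add)
    have "size R = 1" using arg_cong[OF R, of size] sz[OF mP] sz[OF uu(1)] by simp
    then obtain w where "R = {#w#}" by (metis size_1_singleton_mset)
    then have "add_mset v u = add_mset w m" using R by simp
    moreover have "count u v < count u' v" using v(2) by (simp add: in_diff_count)
    ultimately show ?thesis unfolding linear_step_def
      using mP \<open>key m \<le> j\<close> j(1) by (metis order.strict_trans1)
  qed
  ultimately show ?thesis using that by blast
qed

section \<open>Products of edges\<close>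

definition edge_prod :: "'a set multiset \<Rightarrow> 'a multiset" where
  "edge_prod F = (\<Sum>e\<in>#F. mset_set e)"

definition edge_prods :: "'a set set \<Rightarrow> nat \<Rightarrow> 'a multiset set" where
  "edge_prods E s = {edge_prod F | F. size F = s \<and> set_mset F \<subseteq> E}"

lemma edge_prod_simps [simp]:
  "edge_prod {#} = {#}"
  "edge_prod (add_mset e F) = mset_set e + edge_prod F"
  by (simp_all add: edge_prod_def)

lemma edge_prodsI: "size F = s \<Longrightarrow> set_mset F \<subseteq> E \<Longrightarrow> M = edge_prod F \<Longrightarrow> M \<in> edge_prods E s"
  by (auto simp: edge_prods_def)

lemma edge_prodsE:
  assumes "M \<in> edge_prods E s"
  obtains F where "size F = s" "set_mset F \<subseteq> E" "M = edge_prod F"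
  using assms by (auto simp: edge_prods_def)

lemma edge_ideal_pow_eq: "edge_ideal_pow E s = ideal_gen (edge_prods E s)"
proof -
  have *: "sum_list (map mset_set es) = edge_prod (mset es)" for es :: "'a set list"
    by (induction es) auto
  have "{sum_list (map mset_set es) | es. length es = s \<and> set es \<subseteq> E} = edge_prods E s"
    unfolding edge_prods_def * by (auto; metis ex_mset set_mset_mset size_mset)
  then show ?thesis by (simp add: edge_ideal_pow_def)
qed

lemma size_edge_prod: "(\<And>e. e \<in># F \<Longrightarrow> card e = 2) \<Longrightarrow> size (edge_prod F) = 2 * size F"
  by (induction F) auto

lemma size_edge_prods:
  "(\<And>e. e \<in> E \<Longrightarrow> card e = 2) \<Longrightarrow> M \<in> edge_prods E s \<Longrightarrow> size M = 2 * s"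
  by (elim edge_prodsE) (metis size_edge_prod subsetD)

lemma count_edge_prod:
  assumes "\<And>e. e \<in># F \<Longrightarrow> finite e"
  shows "count (edge_prod F) v = size {#e \<in># F. v \<in> e#}"
  using assms by (induction F) (auto simp: count_mset_set')

lemma in_edge_prod:
  assumes "\<And>e. e \<in># F \<Longrightarrow> finite e"
  shows "v \<in># edge_prod F \<longleftrightarrow> (\<exists>e\<in>#F. v \<in> e)"
  using assms by (induction F) auto

lemma finite_edge_prods: "finite E \<Longrightarrow> finite (edge_prods E s)"
proof (rule finite_subset)
  show "edge_prods E s \<subseteq> (\<lambda>es. edge_prod (mset es)) ` {es. set es \<subseteq> E \<and> length es = s}"
    by (auto simp: edge_prods_def; metis (mono_tags, lifting) ex_mset image_eqI mem_Collect_eq set_mset_mset size_mset)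
qed (simp add: finite_lists_length_eq)

lemma edge_prod_replicate: "edge_prod (replicate_mset s e) = repeat_mset s (mset_set e)"
  by (induction s) auto

lemma mset_set_doubleton: "a \<noteq> b \<Longrightarrow> mset_set {a, b} = {#a, b#}"
  by simp

lemma card_2_other:
  assumes "card e = 2" "p \<in> e"
  obtains q where "e = {p, q}" "p \<noteq> q"
  using assms by (metis card_2_iff insert_commute insert_iff singletonD)

section \<open>Necessity: a gap prevents linear quotients\<close>

lemma linear_quotients_imp_gapfree:
  assumes card2: "\<And>e. e \<in> E \<Longrightarrow> card e = 2" and "s \<ge> 1"
    and "linear_quotients (edge_ideal_pow E s)"
  shows "gapfree E"
proof -
  let ?P = "edge_prods E s"
  let ?u = "\<lambda>e. repeat_mset s (mset_set e)"
  obtain key :: "'a multiset \<Rightarrow> nat" where key: "inj_on key ?P"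
    "\<And>u u'. u \<in> ?P \<Longrightarrow> u' \<in> ?P \<Longrightarrow> key u' < key u \<Longrightarrow> linear_step ?P key u u'"
    using linear_quotientsE[of ?P "2 * s"] assms(3) size_edge_prods[OF card2]
    unfolding edge_ideal_pow_eq by metis
  have u: "?u e \<in> ?P" if "e \<in> E" for e
    using that by (intro edge_prodsI[of "replicate_mset s e"]) (auto simp: edge_prod_replicate)
  have fin: "finite e" if "e \<in> E" for e using card2[OF that] by (metis card.infinite zero_neq_numeral)
  have main: "\<exists>f\<in>E. e \<inter> f \<noteq> {} \<and> e' \<inter> f \<noteq> {}"
    if e: "e \<in> E" "e' \<in> E" "e \<inter> e' = {}" and lt: "key (?u e') < key (?u e)" for e e'
  proof (rule ccontr)
    assume no: "\<not> (\<exists>f\<in>E. e \<inter> f \<noteq> {} \<and> e' \<inter> f \<noteq> {})"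
    obtain m v w where m: "m \<in> ?P" "add_mset v (?u e) = add_mset w m" "count (?u e) v < count (?u e') v"
      and less: "key m < key (?u e)"
      using key(2)[OF u[OF e(1)] u[OF e(2)] lt] unfolding linear_step_def by blast
    have v: "v \<in> e'" using m(3) by (auto simp: count_mset_set' split: if_splits)
    \<comment> \<open>Otherwise \<open>m\<close> would be \<open>?u e\<close> itself, whose key is
      not smaller.\<close>
    have "v \<noteq> w" using m(2) less by auto
    have supp: "z \<in> insert v e" if "z \<in># m" for z
    proof -
      have "z \<in># add_mset v (?u e)" using that m(2) by simp
      then show ?thesis using fin[OF e(1)] \<open>s \<ge> 1\<close> by (auto simp: count_mset_set' simp flip: count_greater_zero_iff split: if_splits)
    qed
    have "v \<in># m" using m(2) \<open>v \<noteq> w\<close> by (metis insert_noteq_member)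
    obtain F where F: "set_mset F \<subseteq> E" "m = edge_prod F" using m(1) by (elim edge_prodsE)
    obtain f where f: "f \<in># F" "v \<in> f" using \<open>v \<in># m\<close> F fin in_edge_prod by (metis subsetD)
    \<comment> \<open>The edge \<open>f\<close> meets \<open>e'\<close> in \<open>v\<close>, so it
      avoids \<open>e\<close> by assumption. As all vertices of \<open>m\<close> lie in
      \<open>insert v e\<close>, only \<open>{v}\<close> is left, which is too small for an
      edge.\<close>
    have "f \<subseteq> insert v e" using supp F fin f(1) in_edge_prod[of F] by (metis subsetD subsetI)
    moreover have "e \<inter> f = {}" using no f F(1) v by blast
    ultimately have "f = {v}" using f by blast
    then show False using card2 f(1) F(1) by fastforce
  qed
  show ?thesis unfolding gapfree_def
  proof (intro ballI impI)
    fix e e' assume e: "e \<in> E" "e' \<in> E" "e \<inter> e' = {}"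
    obtain v where "v \<in> e" using card2[OF e(1)] by fastforce
    \<comment> \<open>The exponents are \<open>s\<close> and 0, so the two powers differ; the later
      of them in the order takes the role of \<open>?u e\<close> in \<open>main\<close>.\<close>
    then have "count (?u e) v \<noteq> count (?u e') v"
      using e fin \<open>s \<ge> 1\<close> by (auto simp: count_mset_set')
    then have "?u e \<noteq> ?u e'" by metis
    then have "key (?u e) \<noteq> key (?u e')" using key(1) u e by (metis inj_onD)
    then consider "key (?u e') < key (?u e)" | "key (?u e) < key (?u e')" by linarith
    then show "\<exists>f\<in>E. e \<inter> f \<noteq> {} \<and> e' \<inter> f \<noteq> {}"
      using main[of e e'] main[of e' e] e by cases (auto simp: Int_commute)
  qed
qed

section \<open>Exchange moves\<close>

lemma ex_count_greater:
  assumes "size A = size B" "count A q < count B q"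
  obtains r where "count B r < count A r"
proof (rule ccontr)
  assume "\<not> thesis"
  then have "A \<subseteq># B" using that by (meson mset_subset_eqI not_less)
  then show False using assms by (metis mset_subset_size order_less_irrefl subset_mset.le_imp_less_or_eq)
qed

lemma count_edge_prod_less:
  assumes "\<And>e. e \<in># F \<Longrightarrow> finite e" "\<And>e. e \<in># F' \<Longrightarrow> finite e"
    and "count (edge_prod F) v < count (edge_prod F') v"
  obtains e where "v \<in> e" "count F e < count F' e"
proof (rule ccontr)
  assume "\<not> thesis"
  then have "{#e \<in># F'. v \<in> e#} \<subseteq># {#e \<in># F. v \<in> e#}"
    using that by (force simp: not_less intro!: mset_subset_eqI)
  then show False using assms by (auto simp: count_edge_prod dest: size_mset_mono)
qed

text \<open>Continues an alternating path through \<open>v\<close>: at a vertex of equal degree, an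
  edge that \<open>F'\<close> uses more often is compensated by one that \<open>F\<close> uses more
  often.\<close>

lemma count_edge_prod_balance:
  assumes "\<And>e. e \<in># F \<Longrightarrow> finite e" "\<And>e. e \<in># F' \<Longrightarrow> finite e"
    and "count (edge_prod F) v = count (edge_prod F') v" "v \<in> e" "count F e < count F' e"
  obtains f where "v \<in> f" "count F' f < count F f"
proof -
  have "size {#e \<in># F. v \<in> e#} = size {#e \<in># F'. v \<in> e#}"
    using assms by (simp add: count_edge_prod)
  moreover have "count {#e \<in># F. v \<in> e#} e < count {#e \<in># F'. v \<in> e#} e"
    using assms by simp
  ultimately obtain f where "count {#e \<in># F'. v \<in> e#} f < count {#e \<in># F. v \<in> e#} f"
    by (rule ex_count_greater)
  then show ?thesis using that[of f] by (auto split: if_splits)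
qed

text \<open>The decreasing measure for the augmenting paths in \<open>W_exchange\<close>.\<close>

lemma size_diff_exchange_less:
  assumes "count F' f < count (add_mset f F0) f" "count (add_mset f F0) e < count F' e"
  shows "size (add_mset e F0 - F') < size (add_mset f F0 - F')"
proof -
  have "add_mset f F0 - F' = add_mset f (F0 - F')"
    using assms(1) by (intro multiset_eqI) auto
  moreover have "add_mset e F0 - F' = F0 - F'"
    using assms(2) by (intro multiset_eqI) (auto split: if_splits)
  ultimately show ?thesis by simp
qed

text \<open>Frees the gapfree expansion from its encoding: \<open>x\<close> and \<open>y\<close> are
  the twins and \<open>N\<close> is the old neighbourhood of \<open>x\<close>. The twins enter
  symmetrically.\<close>

locale dominating_twins =
  fixes H :: "'b set set" and x y :: 'b and N :: "'b set"
  assumes card2: "e \<in> H \<Longrightarrow> card e = 2"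
    and xy: "{x, y} \<in> H"
    and xN: "p \<in> N \<Longrightarrow> {x, p} \<in> H"
    and yN: "p \<in> N \<Longrightarrow> {y, p} \<in> H"
    and cover: "e \<in> H \<Longrightarrow> e \<noteq> {x, y} \<Longrightarrow> e \<inter> N \<noteq> {}"
begin

abbreviation W :: "'b set" where "W \<equiv> - (N \<union> {x, y})"

definition degN :: "'b multiset \<Rightarrow> nat" where "degN M = size {#v \<in># M. v \<in> N#}"
definition degW :: "'b multiset \<Rightarrow> nat" where "degW M = size {#v \<in># M. v \<in> W#}"

lemma deg_simps [simp]:
  "degN {#} = 0" "degN (add_mset v M) = (if v \<in> N then 1 else 0) + degN M"
  "degW {#} = 0" "degW (add_mset v M) = (if v \<in> W then 1 else 0) + degW M"
  "degN (A + B) = degN A + degN B"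
  by (auto simp: degN_def degW_def)

text \<open>Any coincidence would turn an edge into a loop, which has only one element.\<close>

lemma distinct_vertices [simp]: "x \<noteq> y" "y \<noteq> x" "x \<notin> N" "y \<notin> N"
  using card2[OF xy] card2[OF xN[of x]] card2[OF yN[of y]] by (auto simp: card_insert_if split: if_splits)

lemma finH: "e \<in> H \<Longrightarrow> finite e"
  using card2 by (metis card.infinite zero_neq_numeral)

lemma edge_neq: "{a, b} \<in> H \<Longrightarrow> a \<noteq> b"
  using card2[of "{a, b}"] by auto

lemma mset_edge: "{a, b} \<in> H \<Longrightarrow> mset_set {a, b} = {#a, b#}"
  by (rule mset_set_doubleton) (rule edge_neq)

lemma size_deg: "size M = count M x + count M y + degN M + degW M"
  by (induction M) auto

lemma degN_edge_ge: "e \<in> H \<Longrightarrow> e \<noteq> {x, y} \<Longrightarrow> 1 \<le> degN (mset_set e)"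
proof -
  assume e: "e \<in> H" "e \<noteq> {x, y}"
  then obtain p where p: "p \<in> N" "p \<in> e" using cover by blast
  obtain q where "e = {p, q}" "p \<noteq> q" using card_2_other[OF card2[OF e(1)] p(2)] .
  then show ?thesis using p by simp
qed

lemma degN_edge_prod_ge:
  "set_mset F \<subseteq> H \<Longrightarrow> {x, y} \<notin># F \<Longrightarrow> size F \<le> degN (edge_prod F)"
proof (induction F)
  case (add e F)
  then have "e \<noteq> {x, y}" by (metis union_single_eq_member)
  then show ?case using add degN_edge_ge[of e] by auto
qed auto

text \<open>Every edge other than \<open>{x, y}\<close> contributes at least one to
  \<open>degN\<close>.\<close>

lemma twin_edge_mem:
  assumes "set_mset F \<subseteq> H" "degN (edge_prod F) < size F"
  shows "{x, y} \<in># F"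
  using degN_edge_prod_ge assms by (meson not_less)

lemma W_edge:
  assumes "e \<in> H" "q \<in> e" "q \<in> W"
  obtains p where "p \<in> N" "p \<noteq> q" "e = {p, q}"
proof -
  have "e \<noteq> {x, y}" using assms by auto
  then obtain p where p: "p \<in> N" "p \<in> e" using cover assms by blast
  obtain r where "e = {p, r}" "p \<noteq> r" using card_2_other[OF card2[OF assms(1)] p(2)] .
  then show ?thesis using that assms p by auto
qed

text \<open>The factor \<open>{x, y}\<close>, present because the \<open>N\<close>-degree is low,
  becomes \<open>{y, p}\<close>.\<close>

lemma move_to_N:
  assumes "M \<in> edge_prods H s" "degN M < s" "p \<in> N"
  obtains R where "M = add_mset x R" "add_mset p R \<in> edge_prods H s"
proof -
  obtain F where F: "size F = s" "set_mset F \<subseteq> H" "M = edge_prod F"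
    using assms(1) by (rule edge_prodsE)
  then obtain F0 where F0: "F = add_mset {x, y} F0"
    using twin_edge_mem assms(2) by (metis mset_add)
  show ?thesis
  proof
    show "M = add_mset x (add_mset y (edge_prod F0))" using F F0 mset_edge[OF xy] by simp
    show "add_mset p (add_mset y (edge_prod F0)) \<in> edge_prods H s"
      using F F0 yN[OF assms(3)] mset_edge[OF yN[OF assms(3)]]
      by (intro edge_prodsI[of "add_mset {y, p} F0"]) auto
  qed
qed

text \<open>An edge at a vertex \<open>q\<close> of \<open>W\<close> has its other end
  \<open>p\<close> in \<open>N\<close>, and \<open>p\<close> is adjacent to both twins; so
  \<open>{p, q}\<close> can become \<open>{z, p}\<close>.\<close>

lemma move_from_W:
  assumes "M \<in> edge_prods H s" "0 < degW M" "z \<in> {x, y}"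
  obtains q R where "q \<in> W" "M = add_mset q R" "add_mset z R \<in> edge_prods H s"
proof -
  obtain F where F: "size F = s" "set_mset F \<subseteq> H" "M = edge_prod F"
    using assms(1) by (rule edge_prodsE)
  have "{#v \<in># M. v \<in> W#} \<noteq> {#}" using assms(2) unfolding degW_def by (metis size_empty less_irrefl)
  then obtain q where "q \<in># {#v \<in># M. v \<in> W#}" by (meson multiset_nonemptyE)
  then have q: "q \<in># M" "q \<in> W" by auto
  obtain e where e: "e \<in># F" "q \<in> e" using q F in_edge_prod finH by (metis subsetD)
  then obtain p where p: "p \<in> N" "p \<noteq> q" "e = {p, q}" using W_edge q F by (metis subsetD)
  obtain F0 where F0: "F = add_mset e F0" using e by (metis mset_add)
  have z: "{z, p} \<in> H" using assms(3) xN yN p by auto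
  show ?thesis
  proof
    show "q \<in> W" by fact
    show "M = add_mset q (add_mset p (edge_prod F0))" using F F0 p by simp
    show "add_mset z (add_mset p (edge_prod F0)) \<in> edge_prods H s"
      using F F0 z mset_edge[OF z] by (intro edge_prodsI[of "add_mset {z, p} F0"]) auto
  qed
qed

lemma move_twin:
  assumes "M \<in> edge_prods H s" "degN M < s" "degW M = 0" "count M x < s"
  obtains R where "M = add_mset y R" "add_mset x R \<in> edge_prods H s"
proof -
  obtain F where F: "size F = s" "set_mset F \<subseteq> H" "M = edge_prod F"
    using assms(1) by (rule edge_prodsE)
  \<comment> \<open>\<open>count M x\<close> is the number of factors through \<open>x\<close>;
    being less than \<open>s\<close>, it leaves a factor that misses \<open>x\<close>.\<close>
  have "{#e \<in># F. x \<in> e#} \<noteq> F"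
    using assms(4) F count_edge_prod[of F x] finH by (metis nat_neq_iff subsetD)
  then obtain e where e: "e \<in># F" "x \<notin> e" by (metis filter_mset_eq_conv multiset_partition filter_mset_cong0 filter_mset_True)
  then have eH: "e \<in> H" and "e \<noteq> {x, y}" using F by auto
  then obtain p where p: "p \<in> N" "p \<in> e" using cover by blast
  obtain r where r: "e = {p, r}" "p \<noteq> r" using card_2_other[OF card2[OF eH] p(2)] .
  obtain F0 where F0: "F = add_mset e F0" using e by (metis mset_add)
  have "r \<notin> W"
  proof
    assume "r \<in> W"
    then have "0 < degW M" unfolding F F0 r using r(2) by simp
    then show False using assms by simp
  qed
  then consider "r = y" | "r \<in> N" using r e by auto
  then show ?thesis
  proof cases
    case 1
    show ?thesis
    proof
      show "M = add_mset y (add_mset p (edge_prod F0))" using F F0 r 1 by simp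
      show "add_mset x (add_mset p (edge_prod F0)) \<in> edge_prods H s"
        using F F0 xN[OF p(1)] mset_edge[OF xN[OF p(1)]] by (intro edge_prodsI[of "add_mset {x, p} F0"]) auto
    qed
  next
    case 2
    have "{x, y} \<in># F0" using twin_edge_mem[of F] F F0 e assms by auto
    then obtain F1 where F1: "F0 = add_mset {x, y} F1" by (metis mset_add)
    show ?thesis
    proof
      show "M = add_mset y ({#x, p, r#} + edge_prod F1)" using F F0 F1 r by simp
      \<comment> \<open>\<open>(xy)(pr) = (xp)(yr)\<close>, and then \<open>y\<close> is traded for \<open>x\<close>.\<close>
      show "add_mset x ({#x, p, r#} + edge_prod F1) \<in> edge_prods H s"
        using F F0 F1 xN[OF p(1)] xN[OF 2] mset_edge[OF xN[OF p(1)]] mset_edge[OF xN[OF 2]]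
        by (intro edge_prodsI[of "add_mset {x, p} (add_mset {x, r} F1)"]) auto
    qed
  qed
qed

text \<open>Augmenting-path argument: swapping an edge at \<open>p\<close> for \<open>{p, q}\<close> either closes the path
  or brings \<open>F\<close> closer to \<open>F'\<close> at the cost of a new deficient vertex.\<close>

lemma W_exchange:
  assumes "set_mset F \<subseteq> H" "set_mset F' \<subseteq> H" "size F = s" "size F' = s"
    and "\<And>v. v \<notin> W \<Longrightarrow> count (edge_prod F) v = count (edge_prod F') v"
    and "degN (edge_prod F) < s"
    and "count (edge_prod F) q < count (edge_prod F') q"
  shows "\<exists>r R. edge_prod F = add_mset r R \<and> count (edge_prod F') r < count (edge_prod F) r
           \<and> add_mset q R \<in> edge_prods H s"
  using assms
proof (induction "size (F - F')" arbitrary: F q rule: less_induct)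
  case less
  note F = less.prems(1) and F' = less.prems(2) and s = less.prems(3,4)
    and eq = less.prems(5) and lowN = less.prems(6) and q = less.prems(7)
  have fin: "\<And>e. e \<in># F \<Longrightarrow> finite e" "\<And>e. e \<in># F' \<Longrightarrow> finite e" using F F' finH by auto
  have qW: "q \<in> W" using q eq by (metis nat_neq_iff)
  obtain e where e: "q \<in> e" "count F e < count F' e"
    using count_edge_prod_less[OF fin q] .
  then have eH: "e \<in> H" using F' by (metis count_inI not_less_zero subsetD)
  then obtain p where p: "p \<in> N" "p \<noteq> q" "e = {p, q}" using W_edge e qW by metis
  \<comment> \<open>The path runs from \<open>q\<close> along \<open>e\<close>, which
    \<open>F\<close> uses less than \<open>F'\<close>, to \<open>p\<close>, and on along
    \<open>f\<close>, which \<open>F\<close> uses more. It can go on since the degrees agree at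
    \<open>p\<close>, outside \<open>W\<close>.\<close>
  have "count (edge_prod F) p = count (edge_prod F') p" using eq p by auto
  then obtain f where f: "p \<in> f" "count F' f < count F f"
    using count_edge_prod_balance[OF fin _ _ e(2), of p] p by auto
  then have "f \<in># F" by (metis count_inI not_less_zero)
  then obtain F0 where F0: "F = add_mset f F0" by (metis mset_add)
  have fH: "f \<in> H" using \<open>f \<in># F\<close> F by auto
  obtain z where z: "f = {p, z}" "p \<noteq> z" using card_2_other[OF card2[OF fH] f(1)] .
  have pq: "{p, q} \<in> H" using eH p by simp
  have "size (edge_prod F) = size (edge_prod F')"
    using F F' s card2 size_edge_prod by (metis subsetD)
  then obtain r where r: "count (edge_prod F') r < count (edge_prod F) r"
    using ex_count_greater q by metis
  have rW: "r \<in> W" using r eq by (metis nat_neq_iff)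
  consider "z \<in> W" | "z \<in> {x, y}" | "z \<in> N" by auto
  then show ?case
  proof cases
    case 1
    \<comment> \<open>Replacing \<open>{p, z}\<close> by \<open>{p, q}\<close> trades
      \<open>z\<close> for \<open>q\<close>. This is the exchange sought if \<open>z\<close> has a
      surplus; otherwise \<open>z\<close> is the new deficient vertex.\<close>
    let ?G = "add_mset e F0"
    have "q \<noteq> z" using e f z p by auto
    have prodF: "edge_prod F = add_mset z (add_mset p (edge_prod F0))" using F0 z by simp
    have prodG: "edge_prod ?G = add_mset q (add_mset p (edge_prod F0))" using p by simp
    show ?thesis
    proof (cases "count (edge_prod F') z < count (edge_prod F) z")
      case True
      moreover have "edge_prod ?G \<in> edge_prods H s"
        using F F0 s eH by (intro edge_prodsI[of ?G]) auto
      ultimately show ?thesis using prodF prodG by metis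
    next
      case False
      have "size (?G - F') < size (F - F')"
        using size_diff_exchange_less[of F' f F0 e] f e F0 by simp
      moreover have "count (edge_prod ?G) v = count (edge_prod F') v" if "v \<notin> W" for v
      proof -
        have "v \<noteq> z" "v \<noteq> q" using that 1 qW by auto
        then show ?thesis using eq[OF that] unfolding prodF prodG by simp
      qed
      moreover have "degN (edge_prod ?G) < s"
        using lowN 1 qW unfolding prodF prodG by auto
      moreover have "count (edge_prod ?G) z < count (edge_prod F') z"
        using False \<open>q \<noteq> z\<close> unfolding prodF prodG by auto
      moreover have "set_mset ?G \<subseteq> H" "size ?G = s" using F F0 s eH by auto
      ultimately obtain t R where t: "edge_prod ?G = add_mset t R"
        "count (edge_prod F') t < count (edge_prod ?G) t" "add_mset z R \<in> edge_prods H s"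
        using less.hyps[of ?G z] F' s(2) by blast
      \<comment> \<open>Even after gaining one, \<open>q\<close> has no surplus over
        \<open>F'\<close>. Hence the trades of \<open>z\<close> for \<open>q\<close> and of
        \<open>t\<close> for \<open>z\<close> compose to a trade of \<open>t\<close> for
        \<open>q\<close>.\<close>
      have "t \<noteq> q" using t(2) q \<open>q \<noteq> z\<close> unfolding prodF prodG by auto
      then obtain R' where R': "R = add_mset q R'" using t(1) prodG
        by (metis add_eq_conv_ex)
      have "edge_prod F = add_mset t (add_mset z R')"
        using t(1) unfolding R' prodF prodG by (simp add: add_mset_commute)
      moreover have "count (edge_prod F') t < count (edge_prod F) t"
        using t(2) \<open>t \<noteq> q\<close> unfolding prodF prodG by auto
      moreover have "add_mset q (add_mset z R') \<in> edge_prods H s"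
        using t(3) R' by (simp add: add_mset_commute)
      ultimately show ?thesis by blast
    qed
  next
    case 2
    have "r \<in># edge_prod F" using r by (metis count_inI not_less_zero)
    then have "r \<in># edge_prod F0" using F0 z p 2 rW by auto
    then obtain g where g: "g \<in># F0" "r \<in> g" using in_edge_prod[of F0] fin(1) F0 by auto
    obtain t where t: "t \<in> N" "t \<noteq> r" "g = {t, r}" using W_edge[of g r] g F F0 rW by auto
    obtain F1 where F1: "F0 = add_mset g F1" using g by (metis mset_add)
    \<comment> \<open>As \<open>z\<close> is a twin, it is adjacent to \<open>t\<close>, and
      \<open>(pz)(tr)\<close> becomes \<open>(pq)(zt)\<close>: \<open>r\<close> is traded for
      \<open>q\<close>.\<close>
    have tz: "{z, t} \<in> H" using 2 xN yN t by auto
    have "edge_prod F = add_mset r ({#p, z, t#} + edge_prod F1)"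
      using F0 F1 z t by simp
    moreover have "add_mset q ({#p, z, t#} + edge_prod F1) \<in> edge_prods H s"
      using F F0 F1 s pq tz mset_edge[OF pq] mset_edge[OF tz]
      by (intro edge_prodsI[of "add_mset {p, q} (add_mset {z, t} F1)"]) auto
    ultimately show ?thesis using r by blast
  next
    case 3
    \<comment> \<open>When \<open>f\<close> lies inside \<open>N\<close>, the factor
      \<open>{x, y}\<close> allows a rearrangement of three edges: \<open>(pz)(xy)(tr)\<close>
      becomes \<open>(pq)(xz)(yt)\<close>.\<close>
    have "{x, y} \<in># F" using twin_edge_mem F lowN s by simp
    moreover have "{x, y} \<noteq> f" using f p by auto
    ultimately have "{x, y} \<in># F0" using F0 by auto
    then obtain F1 where F1: "F0 = add_mset {x, y} F1" by (metis mset_add)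
    have "r \<in># edge_prod F" using r by (metis count_inI not_less_zero)
    then have "r \<in># edge_prod F1" using F0 F1 z p 3 rW mset_edge[OF xy] by auto
    then obtain g where g: "g \<in># F1" "r \<in> g" using in_edge_prod[of F1] fin(1) F0 F1 by auto
    obtain t where t: "t \<in> N" "t \<noteq> r" "g = {t, r}" using W_edge[of g r] g F F0 F1 rW by auto
    obtain F2 where F2: "F1 = add_mset g F2" using g by (metis mset_add)
    have "edge_prod F = add_mset r ({#p, z, x, y, t#} + edge_prod F2)"
      using F0 F1 F2 z t mset_edge[OF xy] by simp
    moreover have "add_mset q ({#p, z, x, y, t#} + edge_prod F2) \<in> edge_prods H s"
      using F F0 F1 F2 s pq mset_edge[OF pq]
        xN[OF 3] mset_edge[OF xN[OF 3]] yN[OF t(1)] mset_edge[OF yN[OF t(1)]]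
      by (intro edge_prodsI[of "add_mset {p, q} (add_mset {x, z} (add_mset {y, t} F2))"]) auto
    ultimately show ?thesis using r by blast
  qed
qed

end

section \<open>The order of the generators\<close>

lemma map_less_map_iff:
  fixes f g :: "'b \<Rightarrow> nat"
  shows "map f vs < map g vs \<longleftrightarrow> (\<exists>as v bs. vs = as @ v # bs \<and> (\<forall>a\<in>set as. f a = g a) \<and> f v < g v)"
proof (induction vs)
  case (Cons u vs)
  show ?case
  proof
    assume "map f (u # vs) < map g (u # vs)"
    then consider "f u < g u" | "f u = g u" "map f vs < map g vs" by auto
    then show "\<exists>as v bs. u # vs = as @ v # bs \<and> (\<forall>a\<in>set as. f a = g a) \<and> f v < g v"
    proof cases
      case 1
      then show ?thesis by (intro exI[of _ "[]"]) auto
    next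
      case 2
      then obtain as v bs where "vs = as @ v # bs" "\<forall>a\<in>set as. f a = g a" "f v < g v"
        using Cons.IH by blast
      then show ?thesis using 2 by (intro exI[of _ "u # as"]) auto
    qed
  next
    assume "\<exists>as v bs. u # vs = as @ v # bs \<and> (\<forall>a\<in>set as. f a = g a) \<and> f v < g v"
    then obtain as v bs where h: "u # vs = as @ v # bs" "\<forall>a\<in>set as. f a = g a" "f v < g v" by blast
    show "map f (u # vs) < map g (u # vs)"
    proof (cases as)
      case (Cons a as')
      then have "map f vs < map g vs" using h Cons.IH by auto
      then show ?thesis using h Cons by auto
    qed (use h in auto)
  qed
qed simp

text \<open>\<open>v\<close> is the first vertex of \<open>vs\<close> where \<open>M\<close> and
  \<open>M'\<close> differ. A vertex \<open>w\<close> with a surplus in \<open>M\<close> does not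
  precede it, so trading \<open>w\<close> for \<open>v\<close> lowers the list at \<open>v\<close>
  first. The bound \<open>c\<close> keeps the subtractions from truncating.\<close>

lemma lex_exchange:
  assumes "map (\<lambda>u. c - count M' u) vs < map (\<lambda>u. c - count M u) vs" "size M \<le> c" "size M' \<le> c"
  obtains v where "count M v < count M' v"
    "\<And>w R. M = add_mset w R \<Longrightarrow> count M' w < count M w \<Longrightarrow>
       map (\<lambda>u. c - count (add_mset v R) u) vs < map (\<lambda>u. c - count M u) vs"
proof -
  obtain as v bs where v: "vs = as @ v # bs" "\<forall>a\<in>set as. c - count M' a = c - count M a"
    "c - count M' v < c - count M v"
    using assms(1) unfolding map_less_map_iff by blast
  have le: "count M u \<le> c" "count M' u \<le> c" for u
    using assms(2,3) count_le_size le_trans by metis+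
  have as: "count M' a = count M a" if "a \<in> set as" for a
    using v(2) that le by (metis diff_diff_cancel)
  show ?thesis
  proof
    show "count M v < count M' v" using v(3) by linarith
    fix w R assume w: "M = add_mset w R" "count M' w < count M w"
    have "v \<noteq> w" using w v(3) by auto
    moreover have "a \<noteq> w \<and> a \<noteq> v" if "a \<in> set as" for a using as[OF that] w(2) v(3) by auto
    ultimately show "map (\<lambda>u. c - count (add_mset v R) u) vs < map (\<lambda>u. c - count M u) vs"
      unfolding map_less_map_iff using v w(1) by (intro exI[of _ as] exI[of _ v] exI[of _ bs]) auto
  qed
qed

lemma ex_count_less_filter:
  assumes "size {#v \<in># A. Q v#} < size {#v \<in># B. Q v#}"
  obtains p where "Q p" "count A p < count B p"
proof (rule ccontr)
  assume "\<not> thesis"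
  then have "{#v \<in># B. Q v#} \<subseteq># {#v \<in># A. Q v#}"
    using that by (force simp: not_less intro!: mset_subset_eqI)
  then show False using assms by (auto dest: size_mset_mono)
qed

section \<open>The key, and linear steps at generators of small \<open>N\<close>-degree\<close>

context dominating_twins
begin

text \<open>The subtractions never truncate on generators; they place larger degrees first.  All generators
  have degree \<open>2 * s\<close>, so at fixed \<open>degN\<close> a smaller \<open>degW\<close> means a larger \<open>{x, y}\<close>-degree.\<close>

definition key :: "nat \<Rightarrow> 'b list \<Rightarrow> ('b multiset \<Rightarrow> nat) \<Rightarrow> 'b multiset \<Rightarrow> nat list" where
  "key s vs f M = (if degN M < s then [1, 2 * s - degN M, degW M, s - count M x] else [0, f M])
                   @ map (\<lambda>v. 2 * s - count M v) vs"

lemma count_le: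
  assumes "M \<in> edge_prods H s"
  shows "count M v \<le> s"
proof -
  obtain F where "size F = s" "set_mset F \<subseteq> H" "M = edge_prod F" using assms by (rule edge_prodsE)
  then show ?thesis using count_edge_prod[of F v] finH by (metis size_filter_mset_lesseq subsetD)
qed

text \<open>The tail of the key determines all exponents, and the leading 0 or 1 keeps heads of
  different lengths apart.\<close>

lemma key_inj:
  assumes "\<Union>H \<subseteq> set vs"
  shows "inj_on (key s vs f) (edge_prods H s)"
proof (rule inj_onI)
  fix M M' assume M: "M \<in> edge_prods H s" "M' \<in> edge_prods H s" and eq: "key s vs f M = key s vs f M'"
  have z: "count L v = 0" if L: "L \<in> edge_prods H s" and v: "v \<notin> set vs" for L v
  proof -
    obtain F where F: "set_mset F \<subseteq> H" "L = edge_prod F" using L by (rule edge_prodsE)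
    then have "v \<notin># L" using in_edge_prod[of F v] finH v assms by blast
    then show ?thesis by (simp add: not_in_iff)
  qed
  have "map (\<lambda>v. 2 * s - count M v) vs = map (\<lambda>v. 2 * s - count M' v) vs"
    using eq by (auto simp: key_def split: if_splits)
  then have "2 * s - count M v = 2 * s - count M' v" if "v \<in> set vs" for v using that by simp
  moreover have "count M v \<le> s" "count M' v \<le> s" for v using count_le M by auto
  ultimately have "count M v = count M' v" if "v \<in> set vs" for v
    using that by (metis diff_diff_cancel le_trans le_add2 mult_2)
  then show "M = M'" using z M by (metis multiset_eqI)
qed

text \<open>The proof follows the entries of the key up to the first difference. In each case
  \<open>M\<close> gains a variable that \<open>M'\<close> contains more often, and its key
  drops.\<close>

lemma linear_step_low:
  assumes M: "M \<in> edge_prods H s" "degN M < s" and M': "M' \<in> edge_prods H s"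
    and lt: "key s vs f M' < key s vs f M"
  shows "linear_step (edge_prods H s) (key s vs f) M M'"
proof -
  let ?P = "edge_prods H s" and ?k = "key s vs f"
  have size: "size M = 2 * s" "size M' = 2 * s" using size_edge_prods card2 M M' by metis+
  have N_step: ?thesis if p: "p \<in> N" "count M p < count M' p" for p
  proof -
    obtain R where R: "M = add_mset x R" "add_mset p R \<in> ?P" using move_to_N[OF M p(1)] .
    \<comment> \<open>The \<open>N\<close>-degree rises by one, which lowers the second entry, or
      the leading 1 to 0 if the degree reaches \<open>s\<close>.\<close>
    show ?thesis by (rule linear_stepI[OF R]) (use R M p in \<open>auto simp: key_def\<close>)
  qed
  have W_step: ?thesis if z: "z \<in> {x, y}" "count M z < count M' z" and "0 < degW M" for z
  proof -
    obtain q R where q: "q \<in> W" and R: "M = add_mset q R" "add_mset z R \<in> ?P"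
      using move_from_W[OF M(1) \<open>0 < degW M\<close> z(1)] .
    show ?thesis by (rule linear_stepI[OF R]) (use R M z q in \<open>auto simp: key_def\<close>)
  qed
  show ?thesis
  proof (cases "degN M < degN M'")
    case True
    then obtain p where "p \<in> N" "count M p < count M' p"
      unfolding degN_def by (rule ex_count_less_filter)
    then show ?thesis by (rule N_step)
  next
    case False
    then have N: "degN M' = degN M" using lt M by (auto simp: key_def split: if_splits)
    then consider "degW M' < degW M" | "degW M' = degW M" "s - count M' x < s - count M x"
      | "degW M' = degW M" "s - count M' x = s - count M x"
        "map (\<lambda>v. 2 * s - count M' v) vs < map (\<lambda>v. 2 * s - count M v) vs"
      using lt M by (auto simp: key_def)
    then show ?thesis
    proof cases
      case 1
      \<comment> \<open>At equal total degree and equal \<open>N\<close>-degree, what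
        \<open>M'\<close> lacks in \<open>W\<close> it has more of at the twins.\<close>
      then have "count M x + count M y < count M' x + count M' y"
        using size_deg[of M] size_deg[of M'] size N by linarith
      then have "count M x < count M' x \<or> count M y < count M' y" by linarith
      then show ?thesis using W_step 1 by auto
    next
      case 2
      then have cx: "count M x < count M' x" "count M x < s" by linarith+
      show ?thesis
      proof (cases "degW M = 0")
        case True
        obtain R where R: "M = add_mset y R" "add_mset x R \<in> ?P"
          using move_twin[OF M True cx(2)] .
        show ?thesis by (rule linear_stepI[OF R]) (use R M cx in \<open>auto simp: key_def\<close>)
      qed (use W_step cx in auto)
    next
      case 3
      have cx: "count M' x = count M x" using 3(2) count_le[OF M(1)] count_le[OF M'] by (metis diff_diff_cancel)
      then have cy: "count M' y = count M y" using size_deg[of M] size_deg[of M'] size N 3(1) by linarith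
      show ?thesis
      \<comment> \<open>An excess of \<open>M'\<close> at a vertex of \<open>N\<close> still permits
        trading \<open>x\<close> for it. Without one, equal \<open>N\<close>-degrees make
        \<open>M\<close> and \<open>M'\<close> agree outside \<open>W\<close>, as
        \<open>W_exchange\<close> demands.\<close>
      proof (cases "\<exists>p\<in>N. count M p < count M' p")
        case False
        have "{#v \<in># M'. v \<in> N#} \<subseteq># {#v \<in># M. v \<in> N#}"
          using False by (force simp: not_less intro!: mset_subset_eqI)
        then have "{#v \<in># M'. v \<in> N#} = {#v \<in># M. v \<in> N#}"
          using N unfolding degN_def by (metis mset_subset_size order_less_irrefl subset_mset.le_imp_less_or_eq)
        then have "count M v = count M' v" if "v \<in> N" for v using that by (metis count_filter_mset)
        then have eq: "count M v = count M' v" if "v \<notin> W" for v using that cx cy by auto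
        obtain q where q: "count M q < count M' q" and lex: "\<And>w R. M = add_mset w R \<Longrightarrow> count M' w < count M w \<Longrightarrow>
           map (\<lambda>u. 2 * s - count (add_mset q R) u) vs < map (\<lambda>u. 2 * s - count M u) vs"
          using lex_exchange[OF 3(3)] size by auto
        obtain F where F: "size F = s" "set_mset F \<subseteq> H" "M = edge_prod F" using M(1) by (rule edge_prodsE)
        obtain F' where F': "size F' = s" "set_mset F' \<subseteq> H" "M' = edge_prod F'" using M' by (rule edge_prodsE)
        obtain r R where R: "M = add_mset r R" "add_mset q R \<in> ?P" and r: "count M' r < count M r"
          using W_exchange[of F F' s q] F F' eq q M(2) by auto
        \<comment> \<open>The exchange stays inside \<open>W\<close>, so the head of the key is
          unchanged and the lexicographic tail decides.\<close>
        have "q \<in> W" "r \<in> W" using eq q r by (metis nat_neq_iff)+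
        then have "?k (add_mset q R) < ?k M" using lex[OF R(1) r] M(2) R(1) by (auto simp: key_def)
        then show ?thesis by (rule linear_stepI[OF R _ q])
      qed (use N_step in auto)
    qed
  qed
qed

text \<open>For the converse, induct on the multiplicity of \<open>{x, y}\<close>. While it occurs,
  the other \<open>s - 1\<close> factors have total \<open>N\<close>-degree at least
  \<open>s\<close>, so one of them is \<open>{p, r}\<close> inside \<open>N\<close>, and
  \<open>(xy)(pr) = (xp)(yr)\<close>.\<close>

lemma edge_prods_without_twin:
  "M \<in> edge_prods (H - {{x, y}}) s \<longleftrightarrow> M \<in> edge_prods H s \<and> s \<le> degN M"
proof
  assume "M \<in> edge_prods (H - {{x, y}}) s"
  then obtain F where F: "size F = s" "set_mset F \<subseteq> H - {{x, y}}" "M = edge_prod F" by (rule edge_prodsE)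
  then have "{x, y} \<notin># F" "set_mset F \<subseteq> H" by auto
  then show "M \<in> edge_prods H s \<and> s \<le> degN M"
    using degN_edge_prod_ge[of F] F by (auto intro: edge_prodsI)
next
  assume "M \<in> edge_prods H s \<and> s \<le> degN M"
  then obtain F where "size F = s" "set_mset F \<subseteq> H" "M = edge_prod F" "s \<le> degN M"
    by (auto elim: edge_prodsE)
  then show "M \<in> edge_prods (H - {{x, y}}) s"
  proof (induction "count F {x, y}" arbitrary: F rule: less_induct)
    case less
    note F = less.prems
    show ?case
    proof (cases "{x, y} \<in># F")
      case False
      then show ?thesis using F by (intro edge_prodsI[of F]) auto
    next
      case True
      then obtain F0 where F0: "F = add_mset {x, y} F0" by (metis mset_add)
      have "\<exists>e\<in>#F0. 1 < degN (mset_set e)"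
      proof (rule ccontr)
        assume "\<not> ?thesis"
        then have "degN (edge_prod F0) \<le> size F0"
          by (induction F0) (auto simp: not_less intro: add_le_mono[of _ 1, simplified])
        then show False using F F0 mset_edge[OF xy] by simp
      qed
      then obtain e where e: "e \<in># F0" "1 < degN (mset_set e)" by blast
      have "e \<in> H" using e F F0 by auto
      then obtain p r where pr: "e = {p, r}" "p \<noteq> r" using card2 by (meson card_2_iff)
      then have prN: "p \<in> N" "r \<in> N" using e(2) by (auto split: if_splits)
      obtain F1 where F1: "F0 = add_mset e F1" using e by (metis mset_add)
      let ?G = "add_mset {x, p} (add_mset {y, r} F1)"
      have ne: "{x, p} \<noteq> {x, y}" "{y, r} \<noteq> {x, y}" "e \<noteq> {x, y}" using prN pr by (auto simp: doubleton_eq_iff)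
      show ?thesis
      proof (rule less.hyps)
        show "count ?G {x, y} < count F {x, y}" using F0 F1 ne by auto
        show "size ?G = s" using F F0 F1 by simp
        show "set_mset ?G \<subseteq> H" using F F0 F1 xN yN prN by auto
        show "M = edge_prod ?G"
          using F F0 F1 pr mset_edge[OF xy] mset_edge[OF xN[OF prN(1)]] mset_edge[OF yN[OF prN(2)]] by simp
      qed (use F in auto)
    qed
  qed
qed

end

section \<open>Expansions\<close>

primrec collapse :: "'a \<Rightarrow> 'a option \<Rightarrow> 'a" where
  "collapse x None = x"
| "collapse x (Some v) = v"

text \<open>The edge joining the twins is removed because it collapses to a single vertex.\<close>

lemma expansion_edge_iff:
  assumes "\<And>e. e \<in> E \<Longrightarrow> card e = 2"
  shows "{u, v} \<in> expansion_edges E x - {{Some x, None}} \<longleftrightarrow> {collapse x u, collapse x v} \<in> E"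
proof -
  have sing: "{a} \<notin> E" for a using assms[of "{a}"] by auto
  have img: "{Some a, Some b} \<in> (\<lambda>e. Some ` e) ` E \<longleftrightarrow> {a, b} \<in> E" for a b
  proof -
    have "{Some a, Some b} = Some ` {a, b}" by simp
    then show ?thesis by (metis (mono_tags, lifting) image_iff inj_Some inj_image_eq_iff)
  qed
  have noimg: "{None, z} \<notin> (\<lambda>e. Some ` e) ` E" "{z, None} \<notin> (\<lambda>e. Some ` e) ` E" for z by auto
  show ?thesis
    by (cases u; cases v)
      (auto simp: expansion_edges_def img noimg sing doubleton_eq_iff insert_commute)
qed

lemma card_expansion_edge:
  assumes "\<And>e. e \<in> E \<Longrightarrow> card e = 2" "e \<in> expansion_edges E x"
  shows "card e = 2"
  using assms by (auto simp: expansion_edges_def card_image)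

text \<open>Any preimages of the two ends of an edge again form an edge, so a factorization of the
  image lifts one factor at a time; conversely, edges collapse to edges.\<close>

lemma collapse_edge_prods_iff:
  assumes card2: "\<And>e. e \<in> E \<Longrightarrow> card e = 2"
  shows "image_mset (collapse x) M \<in> edge_prods E s
     \<longleftrightarrow> M \<in> edge_prods (expansion_edges E x - {{Some x, None}}) s"
proof -
  let ?\<pi> = "collapse x" and ?H' = "expansion_edges E x - {{Some x, None}}"
  have edge_iff: "{u, v} \<in> ?H' \<longleftrightarrow> {?\<pi> u, ?\<pi> v} \<in> E" for u v
    using card2 by (rule expansion_edge_iff)
  have cardH: "card e = 2" if "e \<in> expansion_edges E x" for e
    using card2 that by (rule card_expansion_edge)
  have lift: "\<exists>G. size G = size F \<and> set_mset G \<subseteq> ?H' \<and> M = edge_prod G"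
    if "set_mset F \<subseteq> E" "image_mset ?\<pi> M = edge_prod F" for F M
    using that
  proof (induction F arbitrary: M)
    case (add e F)
    obtain a b where e: "e = {a, b}" "a \<noteq> b" using card2[of e] add.prems by (auto simp: card_2_iff)
    then have "image_mset ?\<pi> M = add_mset a (add_mset b (edge_prod F))" using add.prems by simp
    then obtain a' b' M0 where M: "M = add_mset a' (add_mset b' M0)" "?\<pi> a' = a" "?\<pi> b' = b"
      "image_mset ?\<pi> M0 = edge_prod F"
      by (blast dest: msed_map_invR)
    obtain G where G: "size G = size F" "set_mset G \<subseteq> ?H'" "M0 = edge_prod G"
      using add.IH[OF _ M(4)] add.prems by auto
    have "{a', b'} \<in> ?H'" unfolding edge_iff using M e add.prems by simp
    moreover have "a' \<noteq> b'" using M e by auto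
    ultimately show ?case using G M by (intro exI[of _ "add_mset {a', b'} G"]) auto
  qed auto
  have collapse: "set_mset (image_mset (image ?\<pi>) F) \<subseteq> E \<and> image_mset ?\<pi> (edge_prod F) = edge_prod (image_mset (image ?\<pi>) F)"
    if "set_mset F \<subseteq> ?H'" for F
    using that
  proof (induction F)
    case (add e F)
    obtain u v where e: "e = {u, v}" "u \<noteq> v"
      using cardH[of e] add.prems by (auto simp: card_2_iff)
    have "{?\<pi> u, ?\<pi> v} \<in> E" using add.prems e edge_iff[of u v] by auto
    moreover from this have "?\<pi> u \<noteq> ?\<pi> v" using card2[of "{?\<pi> u, ?\<pi> v}"] by auto
    ultimately show ?case using add e by auto
  qed auto
  show ?thesis
  proof
    assume "image_mset ?\<pi> M \<in> edge_prods E s"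
    then show "M \<in> edge_prods ?H' s" using lift by (metis edge_prodsE edge_prodsI)
  next
    assume "M \<in> edge_prods ?H' s"
    then obtain F where F: "size F = s" "set_mset F \<subseteq> ?H'" "M = edge_prod F" by (rule edge_prodsE)
    then show "image_mset ?\<pi> M \<in> edge_prods E s"
      using collapse[OF F(2)] by (intro edge_prodsI[of "image_mset (image ?\<pi>) F"]) auto
  qed
qed

text \<open>If \<open>e\<close> misses \<open>x\<close>, its copy is disjoint from the edge joining
  the twins, and an edge meeting both must join a twin to a neighbour of \<open>x\<close> on
  \<open>e\<close>.\<close>

lemma gapfree_expansion_cover:
  assumes card2: "\<And>e. e \<in> E \<Longrightarrow> card e = 2" and gap: "gapfree (expansion_edges E x)" and e: "e \<in> E"
  shows "\<exists>b\<in>e. {x, b} \<in> E"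
proof (cases "x \<in> e")
  case True
  then show ?thesis using card_2_other[OF card2[OF e] True] e by (metis insertCI)
next
  case False
  have "Some ` e \<in> expansion_edges E x" "{Some x, None} \<in> expansion_edges E x"
    "Some ` e \<inter> {Some x, None} = {}"
    using e False by (auto simp: expansion_edges_def)
  then obtain f where f: "f \<in> expansion_edges E x" "Some ` e \<inter> f \<noteq> {}" "{Some x, None} \<inter> f \<noteq> {}"
    using gap unfolding gapfree_def by meson
  from f(1) consider g where "g \<in> E" "f = Some ` g" | b where "{x, b} \<in> E" "f = {None, Some b}"
    | "f = {Some x, None}" by (auto simp: expansion_edges_def)
  then show ?thesis
  proof cases
    case 1
    then have "x \<in> g" using f(3) by auto
    then obtain b where "g = {x, b}" using card_2_other[OF card2[OF 1(1)]] by metis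
    then show ?thesis using 1 f(2) False by auto
  qed (use f(2) False in auto)
qed

lemma dominating_twins_expansion:
  assumes card2: "\<And>e. e \<in> E \<Longrightarrow> card e = 2" and gap: "gapfree (expansion_edges E x)"
  shows "dominating_twins (expansion_edges E x) (Some x) None (Some ` {b. {x, b} \<in> E})"
proof
  let ?H = "expansion_edges E x"
  have edge_iff: "{u, v} \<in> ?H - {{Some x, None}} \<longleftrightarrow> {collapse x u, collapse x v} \<in> E" for u v
    using card2 by (rule expansion_edge_iff)
  have cover: "\<exists>b\<in>e. {x, b} \<in> E" if "e \<in> E" for e
    using card2 gap that by (rule gapfree_expansion_cover)
  show "card e = 2" if "e \<in> ?H" for e
    using card2 that by (rule card_expansion_edge)
  show "{Some x, None} \<in> ?H" by (simp add: expansion_edges_def)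
  show "{Some x, p} \<in> ?H" "{None, p} \<in> ?H" if "p \<in> Some ` {b. {x, b} \<in> E}" for p
    using that edge_iff[of "Some x" p] edge_iff[of None p] by auto
  show "e \<inter> Some ` {b. {x, b} \<in> E} \<noteq> {}" if e: "e \<in> ?H" "e \<noteq> {Some x, None}" for e
  proof -
    from e consider g where "g \<in> E" "e = Some ` g" | b where "{x, b} \<in> E" "e = {None, Some b}"
      by (auto simp: expansion_edges_def)
    then show ?thesis
    proof cases
      case 1
      then show ?thesis using cover[of g] by auto
    qed auto
  qed
qed

lemma gapfree_expansion_linear_quotients:
  assumes finE: "finite E" and cardE: "\<And>e. e \<in> E \<Longrightarrow> card e = 2"
    and lq: "linear_quotients (edge_ideal_pow E s)" and gap: "gapfree (expansion_edges E x)"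
  shows "linear_quotients (edge_ideal_pow (expansion_edges E x) s)"
proof -
  let ?H = "expansion_edges E x" and ?\<pi> = "collapse x"
  let ?P = "edge_prods ?H s"
  interpret dominating_twins ?H "Some x" None "Some ` {b. {x, b} \<in> E}"
    using dominating_twins_expansion[OF cardE gap] .
  obtain idx :: "'a multiset \<Rightarrow> nat" where idx: "inj_on idx (edge_prods E s)"
    "\<And>u u'. u \<in> edge_prods E s \<Longrightarrow> u' \<in> edge_prods E s \<Longrightarrow> idx u' < idx u \<Longrightarrow> linear_step (edge_prods E s) idx u u'"
    using linear_quotientsE[of "edge_prods E s" "2 * s"] lq size_edge_prods[OF cardE]
    unfolding edge_ideal_pow_eq by metis
  \<comment> \<open>Combines two descriptions of the products that avoid the edge of the twins: by
    their image and by their \<open>N\<close>-degree.\<close>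
  have high: "image_mset ?\<pi> M \<in> edge_prods E s \<longleftrightarrow> M \<in> ?P \<and> s \<le> degN M" for M
    using collapse_edge_prods_iff[OF cardE] edge_prods_without_twin by metis
  have "finite (\<Union>E)" using finE cardE by (metis card.infinite finite_Union zero_neq_numeral)
  then have "finite {b. {x, b} \<in> E}" by (rule rev_finite_subset) auto
  then have finite_H: "finite ?H" using finE by (simp add: expansion_edges_def)
  then have "finite (\<Union>?H)" using finH by blast
  then obtain vs where vs: "set vs = \<Union>?H" by (metis finite_list)
  define k where "k = key s vs (\<lambda>M. idx (image_mset ?\<pi> M))"
  have step_high: "linear_step ?P k M M'"
    if M: "M \<in> ?P" "M' \<in> ?P" and lt: "k M' < k M" and hi: "s \<le> degN M" for M M'
  proof -
    \<comment> \<open>The key of \<open>M\<close> starts with 0, hence so does the smaller key of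
      \<open>M'\<close>.\<close>
    have hi': "s \<le> degN M'" using lt hi by (auto simp: k_def key_def split: if_splits)
    have \<pi>: "image_mset ?\<pi> M \<in> edge_prods E s" "image_mset ?\<pi> M' \<in> edge_prods E s"
      using high M hi hi' by auto
    have size: "size M = 2 * s" "size M' = 2 * s" using size_edge_prods card2 M by metis+
    consider "idx (image_mset ?\<pi> M') < idx (image_mset ?\<pi> M)"
      | "idx (image_mset ?\<pi> M') = idx (image_mset ?\<pi> M)"
        "map (\<lambda>v. 2 * s - count M' v) vs < map (\<lambda>v. 2 * s - count M v) vs"
      using lt hi hi' by (auto simp: k_def key_def)
    then show ?thesis
    proof cases
      case 1
      obtain m v w where m: "m \<in> edge_prods E s" "idx m < idx (image_mset ?\<pi> M)"
        "add_mset v (image_mset ?\<pi> M) = add_mset w m" "count (image_mset ?\<pi> M) v < count (image_mset ?\<pi> M') v"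
        using idx(2)[OF \<pi> 1] unfolding linear_step_def by blast
      \<comment> \<open>The exponent of \<open>v\<close> in an image is the total degree on the
        fibre over \<open>v\<close>, so the deficit shows at some \<open>v'\<close> in that
        fibre.\<close>
      have "size {#u \<in># M. ?\<pi> u = v#} < size {#u \<in># M'. ?\<pi> u = v#}"
        using m(4) by (simp add: count_conv_size_mset filter_mset_image_mset)
      then obtain v' where v': "?\<pi> v' = v" "count M v' < count M' v'" by (rule ex_count_less_filter)
      have "v \<noteq> w" using m by auto
      then obtain m0 where m0: "image_mset ?\<pi> M = add_mset w m0" "m = add_mset v m0"
        using m(3) unfolding add_eq_conv_ex by blast
      \<comment> \<open>Pulling \<open>w\<close> back to a vertex \<open>w'\<close> of
        \<open>M\<close> and trading it for \<open>v'\<close> lifts the linear step of the original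
        power.\<close>
      then obtain w' R where R: "M = add_mset w' R" "image_mset ?\<pi> R = m0" by (blast dest: msed_map_invR)
      have new: "image_mset ?\<pi> (add_mset v' R) = m" using R m0 v' by simp
      then have "add_mset v' R \<in> ?P" "s \<le> degN (add_mset v' R)" using high m(1) by metis+
      moreover from this have "k (add_mset v' R) < k M" using new m(2) hi by (simp add: k_def key_def)
      ultimately show ?thesis using linear_stepI[OF R(1)] v'(2) by metis
    next
      case 2
      then have same: "image_mset ?\<pi> M' = image_mset ?\<pi> M" using idx(1) \<pi> by (metis inj_onD)
      obtain v where v: "count M v < count M' v" and lex: "\<And>w R. M = add_mset w R \<Longrightarrow> count M' w < count M w \<Longrightarrow>
           map (\<lambda>u. 2 * s - count (add_mset v R) u) vs < map (\<lambda>u. 2 * s - count M u) vs"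
        using lex_exchange[OF 2(2)] size by auto
      \<comment> \<open>Equal images give the fibre of \<open>v\<close> the same degree in
        \<open>M\<close> and \<open>M'\<close>, so some \<open>w\<close> in this fibre has a surplus
        in \<open>M\<close>. Trading \<open>w\<close> for \<open>v\<close> preserves the image and
        with it \<open>idx\<close>.\<close>
      have "size {#u \<in># M. ?\<pi> u = ?\<pi> v#} = size {#u \<in># M'. ?\<pi> u = ?\<pi> v#}"
        using arg_cong[OF same, of "\<lambda>A. count A (?\<pi> v)"] by (simp add: count_conv_size_mset filter_mset_image_mset)
      moreover have "count {#u \<in># M. ?\<pi> u = ?\<pi> v#} v < count {#u \<in># M'. ?\<pi> u = ?\<pi> v#} v" using v by simp
      ultimately obtain w where "count {#u \<in># M'. ?\<pi> u = ?\<pi> v#} w < count {#u \<in># M. ?\<pi> u = ?\<pi> v#} w"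
        by (rule ex_count_greater)
      then have w: "?\<pi> w = ?\<pi> v" "count M' w < count M w" by (auto split: if_splits)
      then obtain R where R: "M = add_mset w R" by (metis count_inI mset_add not_less_zero)
      have new: "image_mset ?\<pi> (add_mset v R) = image_mset ?\<pi> M" using R w by simp
      then have "add_mset v R \<in> ?P" "s \<le> degN (add_mset v R)" using high \<pi>(1) by metis+
      moreover from this have "k (add_mset v R) < k M"
        using new hi lex[OF R w(2)] by (simp add: k_def key_def)
      ultimately show ?thesis using linear_stepI[OF R] v by metis
    qed
  qed
  have "linear_step ?P k M M'" if "M \<in> ?P" "M' \<in> ?P" "k M' < k M" for M M'
    using step_high linear_step_low that unfolding k_def by (meson not_less)
  moreover have "inj_on k ?P" unfolding k_def using key_inj vs by blast
  ultimately show ?thesis unfolding edge_ideal_pow_eq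
    using linear_quotientsI[of ?P "2 * s" k] finite_edge_prods[OF finite_H] size_edge_prods[OF card2] by metis
qed

theorem theorem3p4:
  fixes V :: "'a set" and E :: "'a set set" and x :: 'a and s :: nat
  assumes "simple_graph V E"
    and "s \<ge> 1"
    and "linear_quotients (edge_ideal_pow E s)"
    and "x \<in> V"
  shows "linear_quotients (edge_ideal_pow (expansion_edges E x) s)
           \<longleftrightarrow> gapfree (expansion_edges E x)"
proof
  have card2: "\<And>e. e \<in> E \<Longrightarrow> card e = 2" using assms(1) by (simp add: simple_graph_def)
  have "E \<subseteq> Pow V" "finite V" using assms(1) by (auto simp: simple_graph_def)
  then have "finite E" by (meson finite_Pow_iff finite_subset)
  then show "linear_quotients (edge_ideal_pow (expansion_edges E x) s)" if "gapfree (expansion_edges E x)"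
    using card2 assms(3) that by (rule gapfree_expansion_linear_quotients)
  have "card e = 2" if "e \<in> expansion_edges E x" for e
    using card2 that by (rule card_expansion_edge)
  then show "gapfree (expansion_edges E x)" if "linear_quotients (edge_ideal_pow (expansion_edges E x) s)"
    using assms(2) that by (rule linear_quotients_imp_gapfree)
qed

end
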